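(* Let $\Lambda$ be a $\Lambda$-sequence and let $f\in\Lambda BV$. Then for every natural number $n\ge 1$, $V_\Lambda(K_nf)\leq V_\Lambda(f)$.
   Context: A $\Lambda$-sequence is a nondecreasing sequence $\Lambda=(\lambda_k)_{k\ge 1}$ of positive reals with $\sum_k \frac{1}{\lambda_k}=\infty$. For a closed interval $I=[a,b]\subseteq[0,1]$ and $f:[0,1]\to\mathbb{R}$ write $|f(I)|=|f(b)-f(a)|$. Closed intervals are nonoverlapping if any two of them intersect at most at endpoints. For a finite sequence $\mathcal{I}=\langle I_1,\dots,I_m\rangle$ (in any order) of nonoverlapping closed intervals contained in $[0,1]$ put $\sigma_\Lambda(f,\mathcal{I})=\sum_{k=1}^m\frac{|f(I_k)|}{\lambda_k}$. The $\Lambda$-variation of $f$ is $V_\Lambda(f)=\sup_{\mathcal{I}}\sigma_\Lambda(f,\mathcal{I})\in[0,\infty]$, the supremum being over all such finite sequences. $\Lambda BV$ is the set of all $f:[0,1]\to\mathbb{R}$ with $V_\Lambda(f)<\infty$; every such $f$ is a bounded Borel function, hence Lebesgue integrable on $[0,1]$. For $f$ integrable on $[0,1]$ and $n\ge1$ the $n$-th Kantorovich polynomial of $f$, viewed as a function on $[0,1]$, is $K_nf(x)=\sum_{k=0}^n \binom{n}{k}x^k(1-x)^{n-k}(n+1)\int_{k/(n+1)}^{(k+1)/(n+1)}f(t)\,dt$. *)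

theory Defs
  imports "HOL-Analysis.Analysis"
begin

text \<open>
  Sequences are indexed from \<open>1\<close>; the value at \<open>0\<close> is never used. A function on the unit interval
  is represented by a total function of type \<^typ>\<open>real \<Rightarrow> real\<close>; none of the notions below
  depends on its values outside the unit interval.
\<close>

definition Lambda_sequence :: "(nat \<Rightarrow> real) \<Rightarrow> bool" where
  "Lambda_sequence \<Lambda> \<longleftrightarrow>
     (\<forall>k\<ge>1. 0 < \<Lambda> k) \<and>
     (\<forall>j k. 1 \<le> j \<and> j \<le> k \<longrightarrow> \<Lambda> j \<le> \<Lambda> k) \<and>
     filterlim (\<lambda>N. \<Sum>k=1..N. 1 / \<Lambda> k) at_top sequentially"

text \<open>
  The pair \<open>(a, b)\<close> with \<open>a \<le> b\<close> stands for the closed interval from \<open>a\<close> to \<open>b\<close>. Degenerate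
  intervals are allowed; as they contribute nothing and \<open>\<Lambda>\<close> is nondecreasing, they do not
  affect the variation.
\<close>

definition nonoverlapping :: "real \<times> real \<Rightarrow> real \<times> real \<Rightarrow> bool" where
  "nonoverlapping I J \<longleftrightarrow>
     {fst I..snd I} \<inter> {fst J..snd J} \<subseteq> {fst I, snd I} \<inter> {fst J, snd J}"

definition interval_families :: "(real \<times> real) list set" where
  "interval_families = {\<I>.
     (\<forall>I\<in>set \<I>. 0 \<le> fst I \<and> fst I \<le> snd I \<and> snd I \<le> 1) \<and>
     (\<forall>i j. i < j \<and> j < length \<I> \<longrightarrow> nonoverlapping (\<I> ! i) (\<I> ! j))}"

definition Lambda_sum :: "(nat \<Rightarrow> real) \<Rightarrow> (real \<Rightarrow> real) \<Rightarrow> (real \<times> real) list \<Rightarrow> real" where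
  "Lambda_sum \<Lambda> f \<I> =
     (\<Sum>k=1..length \<I>. \<bar>f (snd (\<I> ! (k - 1))) - f (fst (\<I> ! (k - 1)))\<bar> / \<Lambda> k)"

definition Lambda_variation :: "(nat \<Rightarrow> real) \<Rightarrow> (real \<Rightarrow> real) \<Rightarrow> ennreal" where
  "Lambda_variation \<Lambda> f = (SUP \<I>\<in>interval_families. ennreal (Lambda_sum \<Lambda> f \<I>))"

definition Lambda_BV :: "(nat \<Rightarrow> real) \<Rightarrow> (real \<Rightarrow> real) set" where
  "Lambda_BV \<Lambda> = {f. Lambda_variation \<Lambda> f < \<infinity>}"

definition Kantorovich :: "nat \<Rightarrow> (real \<Rightarrow> real) \<Rightarrow> real \<Rightarrow> real" where
  "Kantorovich n f x =
     (\<Sum>k=0..n. Bernstein n k x * real (n + 1) *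
        (LINT t:{real k / real (n + 1)..real (k + 1) / real (n + 1)}|lebesgue. f t))"

end

theory Submission
  imports Defs "HOL-Probability.Probability_Measure"
begin

text \<open>
  The Kantorovich polynomial is an expectation. Let \<open>T\<^sub>1, \<dots>, T\<^sub>n, U\<close> be independent and uniform on
  the unit interval, and let \<open>S t\<close> be the number of \<open>i\<close> with \<open>T\<^sub>i \<le> t\<close>. As \<open>S t\<close> is binomially
  distributed with parameters \<open>n\<close> and \<open>t\<close>, the value of the \<open>n\<close>-th Kantorovich polynomial of \<open>f\<close>
  at \<open>t\<close> is the expectation of \<open>f ((S t + U) / (n + 1))\<close>. The same random variables serve all \<open>t\<close>,
  and for each outcome the map \<open>t \<mapsto> (S t + U) / (n + 1)\<close> is nondecreasing from the unit interval to
  itself. It therefore sends a sequence of nonoverlapping intervals to another one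
  (\<open>map_interval_families\<close>), on which the weighted sum for \<open>f\<close> is at most the variation of \<open>f\<close>. The
  triangle inequality for expectations (\<open>weighted_sum_abs_expectation_le\<close>) carries this bound over
  to the polynomial.

  The variables \<open>T\<^sub>i\<close> are integrated out one at a time, by induction on \<open>n\<close>
  (\<open>Bernstein_weighted_increments_le\<close>), which avoids a product measure; the variable \<open>U\<close> is handled
  last. That the averages of \<open>f\<close> over the cells are such expectations requires \<open>f\<close> to be bounded and
  measurable. Measurability holds because \<open>f\<close> has only countably many discontinuities: the
  divergence of \<open>\<Sum> 1 / \<lambda>\<^sub>k\<close> leaves room for only finitely many jumps above any given height.
\<close>

section \<open>Families of nonoverlapping intervals\<close>

lemma Lambda_sequence_pos: "Lambda_sequence \<Lambda> \<Longrightarrow> k \<ge> 1 \<Longrightarrow> 0 < \<Lambda> k"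
  unfolding Lambda_sequence_def by blast

lemma Lambda_sum_le_variation:
  assumes "f \<in> Lambda_BV \<Lambda>" "\<I> \<in> interval_families"
  shows "Lambda_sum \<Lambda> f \<I> \<le> enn2real (Lambda_variation \<Lambda> f)"
proof -
  have "ennreal (Lambda_sum \<Lambda> f \<I>) \<le> Lambda_variation \<Lambda> f"
    unfolding Lambda_variation_def by (rule SUP_upper) fact
  also have "\<dots> = ennreal (enn2real (Lambda_variation \<Lambda> f))"
    using assms(1) by (simp add: Lambda_BV_def)
  finally show ?thesis
    by (simp add: ennreal_le_iff)
qed

text \<open>
  If the intersection is not empty, it is an interval contained in a finite set, hence a single
  point. As this point is an end of both intervals, one of them lies to its left and the other to
  its right.
\<close>

lemma nonoverlapping_imp_ordered:
  assumes "nonoverlapping I J" "fst I \<le> snd I" "fst J \<le> snd J"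
  shows "snd I \<le> fst J \<or> snd J \<le> fst I"
proof (rule ccontr)
  define l where "l = max (fst I) (fst J)"
  define r where "r = min (snd I) (snd J)"
  assume *: "\<not> ?thesis"
  have "l \<le> r"
    using assms * by (auto simp: l_def r_def)
  have sub: "{l..r} \<subseteq> {fst I, snd I} \<inter> {fst J, snd J}"
    using assms(1) unfolding nonoverlapping_def l_def r_def by (auto simp: subset_iff)
  hence "finite {l..r}"
    using finite_subset by blast
  with \<open>l \<le> r\<close> have lr: "l = r"
    using infinite_Icc[of l r] by (cases "l < r") auto
  with sub have "l \<in> {fst I, snd I} \<inter> {fst J, snd J}"
    by auto
  with * lr show False
    by (auto simp: l_def r_def max_def min_def split: if_splits)
qed

lemma ordered_imp_nonoverlapping:
  assumes "snd I \<le> fst J \<or> snd J \<le> fst I" "fst I \<le> snd I" "fst J \<le> snd J"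
  shows "nonoverlapping I J"
  using assms unfolding nonoverlapping_def by auto

text \<open>
  Once nonoverlapping is expressed by order, it is preserved by any nondecreasing map, even one that
  collapses intervals to points.
\<close>

lemma map_interval_families:
  assumes fam: "\<I> \<in> interval_families"
    and mono: "\<And>s t. 0 \<le> s \<Longrightarrow> s \<le> t \<Longrightarrow> t \<le> 1 \<Longrightarrow> \<phi> s \<le> \<phi> t"
    and range: "\<And>t. 0 \<le> t \<Longrightarrow> t \<le> 1 \<Longrightarrow> 0 \<le> \<phi> t \<and> \<phi> t \<le> 1"
  shows "map (map_prod \<phi> \<phi>) \<I> \<in> interval_families"
proof -
  have bnd: "0 \<le> fst I" "fst I \<le> snd I" "snd I \<le> 1" if "I \<in> set \<I>" for I
    using fam that by (auto simp: interval_families_def)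
  have "nonoverlapping (map_prod \<phi> \<phi> (\<I> ! i)) (map_prod \<phi> \<phi> (\<I> ! j))"
    if "i < j" "j < length \<I>" for i j
  proof -
    have mem: "\<I> ! i \<in> set \<I>" "\<I> ! j \<in> set \<I>"
      using that by auto
    have "nonoverlapping (\<I> ! i) (\<I> ! j)"
      using fam that by (auto simp: interval_families_def)
    hence "snd (\<I> ! i) \<le> fst (\<I> ! j) \<or> snd (\<I> ! j) \<le> fst (\<I> ! i)"
      using bnd mem by (intro nonoverlapping_imp_ordered)
    thus ?thesis
      using bnd[OF mem(1)] bnd[OF mem(2)]
      by (intro ordered_imp_nonoverlapping) (auto intro!: mono)
  qed
  moreover have "0 \<le> \<phi> (fst I) \<and> \<phi> (fst I) \<le> \<phi> (snd I) \<and> \<phi> (snd I) \<le> 1" if "I \<in> set \<I>" for I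
    using bnd[OF that] by (auto intro!: mono simp: range)
  ultimately show ?thesis
    by (auto simp: interval_families_def)
qed

section \<open>Functions of bounded variation are bounded and measurable\<close>

lemma Lambda_BV_bounded:
  assumes L: "Lambda_sequence \<Lambda>" and f: "f \<in> Lambda_BV \<Lambda>"
  obtains B where "\<And>t. t \<in> {0..1} \<Longrightarrow> \<bar>f t\<bar> \<le> B"
proof
  fix t :: real assume t: "t \<in> {0..1}"
  have "[(0, t)] \<in> interval_families"
    using t by (auto simp: interval_families_def)
  from Lambda_sum_le_variation[OF f this]
  have "\<bar>f t - f 0\<bar> / \<Lambda> 1 \<le> enn2real (Lambda_variation \<Lambda> f)"
    by (simp add: Lambda_sum_def)
  hence "\<bar>f t - f 0\<bar> \<le> enn2real (Lambda_variation \<Lambda> f) * \<Lambda> 1"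
    using Lambda_sequence_pos[OF L, of 1] by (simp add: field_simps)
  thus "\<bar>f t\<bar> \<le> \<bar>f 0\<bar> + enn2real (Lambda_variation \<Lambda> f) * \<Lambda> 1"
    by linarith
qed

lemma finite_separated:
  fixes P :: "real set"
  assumes "finite P"
  obtains d where "d > 0" "\<And>x y. x \<in> P \<Longrightarrow> y \<in> P \<Longrightarrow> x \<noteq> y \<Longrightarrow> d \<le> \<bar>x - y\<bar>"
proof
  let ?D = "insert 1 ((\<lambda>(x, y). \<bar>x - y\<bar>) ` {(x, y) \<in> P \<times> P. x \<noteq> y})"
  have fin: "finite ?D"
    using assms by (auto intro!: finite_imageI intro: finite_subset[of _ "P \<times> P"])
  show "Min ?D > 0"
    using fin by (subst Min_gr_iff) auto
  show "Min ?D \<le> \<bar>x - y\<bar>" if "x \<in> P" "y \<in> P" "x \<noteq> y" for x y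
    using fin that by (intro Min_le) auto
qed

text \<open>
  Each jump is witnessed by an interval with one end at the jump point and length below half the
  smallest distance between two of the points. These intervals are disjoint, so together they form
  an admissible family. The points \<open>0\<close> and \<open>1\<close> take part in the separation to keep the intervals
  inside the unit interval.
\<close>

lemma Lambda_BV_jumps_bounded:
  assumes L: "Lambda_sequence \<Lambda>" and f: "f \<in> Lambda_BV \<Lambda>" and "\<epsilon> > 0"
    and fin: "finite P" and P: "P \<subseteq> {0<..<1}"
    and jump: "\<And>x d. x \<in> P \<Longrightarrow> d > 0 \<Longrightarrow> \<exists>y. \<bar>y - x\<bar> < d \<and> \<epsilon> \<le> \<bar>f y - f x\<bar>"
  shows "\<epsilon> * (\<Sum>k=1..card P. 1 / \<Lambda> k) \<le> enn2real (Lambda_variation \<Lambda> f)"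
proof -
  have "finite (P \<union> {0, 1})"
    using fin by simp
  then obtain d where d: "d > 0"
    "\<And>x y. x \<in> P \<union> {0, 1} \<Longrightarrow> y \<in> P \<union> {0, 1} \<Longrightarrow> x \<noteq> y \<Longrightarrow> d \<le> \<bar>x - y\<bar>"
    by (rule finite_separated) blast
  have "\<forall>x\<in>P. \<exists>y. \<bar>y - x\<bar> < d / 2 \<and> \<epsilon> \<le> \<bar>f y - f x\<bar>"
    using jump d(1) half_gt_zero by blast
  then obtain y where y: "\<And>x. x \<in> P \<Longrightarrow> \<bar>y x - x\<bar> < d / 2"
      "\<And>x. x \<in> P \<Longrightarrow> \<epsilon> \<le> \<bar>f (y x) - f x\<bar>"
    by metis
  obtain xs where xs: "distinct xs" "set xs = P"
    using fin finite_distinct_list by blast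
  define I where "I x = (min x (y x), max x (y x))" for x
  have range: "0 \<le> fst (I x) \<and> fst (I x) \<le> snd (I x) \<and> snd (I x) \<le> 1" if x: "x \<in> P" for x
  proof -
    from x have "d \<le> \<bar>x - 0\<bar>" "d \<le> \<bar>x - 1\<bar>" "0 < x" "x < 1"
      using d(2)[of x 0] d(2)[of x 1] P by auto
    with y(1)[OF x] have "0 \<le> y x" "y x \<le> 1"
      by linarith+
    with \<open>0 < x\<close> \<open>x < 1\<close> show ?thesis
      by (auto simp: I_def)
  qed
  have "nonoverlapping (I (xs ! i)) (I (xs ! j))" if ij: "i < j" "j < length xs" for i j
  proof -
    from ij have mem: "xs ! i \<in> P" "xs ! j \<in> P" and ne: "xs ! i \<noteq> xs ! j"
      using xs by (auto simp: distinct_conv_nth)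
    have "d \<le> \<bar>xs ! i - xs ! j\<bar>"
      using d(2) mem ne by auto
    hence sep: "xs ! i + d \<le> xs ! j \<or> xs ! j + d \<le> xs ! i"
      by linarith
    have near: "x - d / 2 < y x" "y x < x + d / 2" if "x \<in> P" for x
      using y(1)[OF that] by linarith+
    show "nonoverlapping (I (xs ! i)) (I (xs ! j))"
      using sep near[OF mem(1)] near[OF mem(2)]
      by (intro ordered_imp_nonoverlapping) (auto simp: I_def)
  qed
  with range have "map I xs \<in> interval_families"
    by (simp add: interval_families_def xs(2))
  hence "Lambda_sum \<Lambda> f (map I xs) \<le> enn2real (Lambda_variation \<Lambda> f)"
    by (rule Lambda_sum_le_variation[OF f])
  moreover have "\<epsilon> * (\<Sum>k=1..card P. 1 / \<Lambda> k) \<le> Lambda_sum \<Lambda> f (map I xs)"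
  proof -
    have len: "length xs = card P"
      using xs distinct_card by metis
    have "\<epsilon> * (1 / \<Lambda> k) \<le> \<bar>f (snd (map I xs ! (k - 1))) - f (fst (map I xs ! (k - 1)))\<bar> / \<Lambda> k"
      if "k \<in> {1..card P}" for k
    proof -
      have "k - 1 < length xs"
        using that len by auto
      moreover from this have "xs ! (k - 1) \<in> P"
        using xs by auto
      ultimately have "\<epsilon> \<le> \<bar>f (snd (map I xs ! (k - 1))) - f (fst (map I xs ! (k - 1)))\<bar>"
        using y(2)[of "xs ! (k - 1)"] by (auto simp: I_def max_def min_def abs_minus_commute)
      thus ?thesis
        using Lambda_sequence_pos[OF L, of k] that by (simp add: divide_right_mono)
    qed
    thus ?thesis
      unfolding Lambda_sum_def sum_distrib_left length_map len by (rule sum_mono)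
  qed
  ultimately show ?thesis by linarith
qed

text \<open>
  By the preceding bound and the divergence of \<open>\<Sum> 1 / \<lambda>\<^sub>k\<close>, for each \<open>\<epsilon> > 0\<close> only finitely many
  points have a jump of height at least \<open>\<epsilon>\<close>; every discontinuity has one of height at least
  \<open>1 / (i + 1)\<close> for some \<open>i\<close>.
\<close>

lemma Lambda_BV_countable_discontinuities:
  assumes L: "Lambda_sequence \<Lambda>" and f: "f \<in> Lambda_BV \<Lambda>"
  shows "countable {x \<in> {0<..<1}. \<not> isCont f x}"
proof -
  define S where "S \<epsilon> = {x \<in> {0<..<1}. \<forall>d>0. \<exists>y. \<bar>y - x\<bar> < d \<and> \<epsilon> \<le> \<bar>f y - f x\<bar>}" for \<epsilon>
  have fin: "finite (S \<epsilon>)" if eps: "\<epsilon> > 0" for \<epsilon>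
  proof (rule ccontr)
    assume inf: "infinite (S \<epsilon>)"
    have "filterlim (\<lambda>N. \<Sum>k=1..N. 1 / \<Lambda> k) at_top sequentially"
      using L by (simp add: Lambda_sequence_def)
    hence "\<forall>\<^sub>F N in sequentially. enn2real (Lambda_variation \<Lambda> f) / \<epsilon> < (\<Sum>k=1..N. 1 / \<Lambda> k)"
      by (simp add: filterlim_at_top_dense)
    then obtain N where N: "enn2real (Lambda_variation \<Lambda> f) / \<epsilon> < (\<Sum>k=1..N. 1 / \<Lambda> k)"
      using eventually_happens'[OF sequentially_bot] by blast
    obtain P where P: "finite P" "card P = N" "P \<subseteq> S \<epsilon>"
      using infinite_arbitrarily_large[OF inf] by blast
    have "\<epsilon> * (\<Sum>k=1..card P. 1 / \<Lambda> k) \<le> enn2real (Lambda_variation \<Lambda> f)"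
      using P by (intro Lambda_BV_jumps_bounded[OF L f eps]) (auto simp: S_def)
    with N P eps show False
      by (simp add: field_simps)
  qed
  have sub: "{x \<in> {0<..<1}. \<not> isCont f x} \<subseteq> (\<Union>i. S (1 / real (Suc i)))"
  proof
    fix x assume x: "x \<in> {x \<in> {0<..<1}. \<not> isCont f x}"
    hence "\<not> (\<forall>\<epsilon>>0. \<exists>d>0. \<forall>y. \<bar>y - x\<bar> < d \<longrightarrow> \<bar>f y - f x\<bar> < \<epsilon>)"
      by (simp add: continuous_at_eps_delta dist_real_def)
    then obtain \<epsilon> where e: "\<epsilon> > 0" "\<And>d. d > 0 \<Longrightarrow> \<exists>y. \<bar>y - x\<bar> < d \<and> \<epsilon> \<le> \<bar>f y - f x\<bar>"
      by (meson not_less)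
    obtain i where "1 / real (Suc i) < \<epsilon>"
      using e(1) nat_approx_posE by blast
    hence "\<exists>y. \<bar>y - x\<bar> < d \<and> 1 / real (Suc i) \<le> \<bar>f y - f x\<bar>" if "d > 0" for d
      using e(2)[OF that] by (meson less_imp_le order_trans)
    hence "x \<in> S (1 / real (Suc i))"
      using x unfolding S_def by blast
    thus "x \<in> (\<Union>i. S (1 / real (Suc i)))" by blast
  qed
  have "countable (\<Union>i. S (1 / real (Suc i)))"
    by (intro countable_UN) (simp_all add: countable_finite fin)
  with sub show ?thesis
    by (rule countable_subset)
qed

lemma Lambda_BV_borel_measurable:
  assumes L: "Lambda_sequence \<Lambda>" and f: "f \<in> Lambda_BV \<Lambda>"
  shows "(\<lambda>t. indicator {0..1} t * f t) \<in> borel_measurable borel"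
proof (rule borel_measurable_continuous_countable_exceptions)
  let ?X = "{0, 1} \<union> {x \<in> {0<..<1}. \<not> isCont f x}"
  let ?g = "\<lambda>t. indicator {0..1} t * f t"
  show "countable ?X"
    using Lambda_BV_countable_discontinuities[OF L f] by simp
  show "continuous_on (- ?X) ?g"
  proof (intro continuous_at_imp_continuous_on ballI)
    fix x assume x: "x \<in> - ?X"
    show "isCont ?g x"
    proof (cases "x \<in> {0<..<1}")
      case True
      hence "\<forall>\<^sub>F t in nhds x. t \<in> {0<..<1}"
        by (intro eventually_nhds_in_open) auto
      hence "\<forall>\<^sub>F t in nhds x. ?g t = f t"
        by eventually_elim (auto simp: indicator_def)
      thus ?thesis
        using x True by (subst isCont_cong) auto
    next
      case False
      with x have "x \<in> - {0..1}"
        by auto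
      hence "\<forall>\<^sub>F t in nhds x. t \<in> - {0..1}"
        by (intro eventually_nhds_in_open) auto
      hence "\<forall>\<^sub>F t in nhds x. ?g t = 0"
        by eventually_elim (auto simp: indicator_def)
      thus ?thesis
        by (subst isCont_cong[where g = "\<lambda>_. 0"]) auto
    qed
  qed
qed

section \<open>Averaging over the unit interval\<close>

abbreviation unit_lborel :: "real measure" where
  "unit_lborel \<equiv> restrict_space lborel {0..1}"

lemma prob_space_unit_lborel: "prob_space unit_lborel"
  by (rule prob_spaceI) (simp add: emeasure_restrict_space space_restrict_space)

lemma weighted_sum_abs_expectation_le:
  fixes D :: "'j \<Rightarrow> 'b \<Rightarrow> real"
  assumes "prob_space M" and int: "\<And>j. j \<in> J \<Longrightarrow> integrable M (D j)"
    and w: "\<And>j. j \<in> J \<Longrightarrow> 0 \<le> w j"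
    and bound: "\<And>\<omega>. \<omega> \<in> space M \<Longrightarrow> (\<Sum>j\<in>J. w j * \<bar>D j \<omega>\<bar>) \<le> C"
  shows "(\<Sum>j\<in>J. w j * \<bar>\<integral>\<omega>. D j \<omega> \<partial>M\<bar>) \<le> C"
proof -
  interpret prob_space M by fact
  have "(\<Sum>j\<in>J. w j * \<bar>\<integral>\<omega>. D j \<omega> \<partial>M\<bar>) \<le> (\<Sum>j\<in>J. w j * (\<integral>\<omega>. \<bar>D j \<omega>\<bar> \<partial>M))"
    by (intro sum_mono mult_left_mono integral_abs_bound w)
  also have "\<dots> = (\<integral>\<omega>. (\<Sum>j\<in>J. w j * \<bar>D j \<omega>\<bar>) \<partial>M)"
    using int by (subst Bochner_Integration.integral_sum) auto
  also have "\<dots> \<le> C"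
    using int bound by (intro integral_le_const) auto
  finally show ?thesis .
qed

text \<open>
  The event \<open>T \<le> t\<close> for uniform \<open>T\<close> has probability \<open>t\<close>. This turns the convex combination in the
  recursion of the Bernstein polynomials into an expectation with the same \<open>T\<close> for all \<open>t\<close>.
\<close>

lemma
  assumes "0 \<le> t" "t \<le> 1"
  shows integrable_unit_threshold: "integrable unit_lborel (\<lambda>T. if T \<le> t then b else a :: real)"
    and integral_unit_threshold:
      "(\<integral>T. (if T \<le> t then b else a) \<partial>unit_lborel) = (1 - t) * a + t * b"
proof -
  interpret prob_space unit_lborel by (rule prob_space_unit_lborel)
  have set: "{0..t} \<in> sets unit_lborel"
    using assms by (auto simp: sets_restrict_space_iff)
  have eq: "(if T \<le> t then b else a) = a + (b - a) * indicator {0..t} T"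
    if "T \<in> space unit_lborel" for T
    using that by (auto simp: space_restrict_space indicator_def)
  have int: "integrable unit_lborel (\<lambda>T. a + (b - a) * indicator {0..t} T)"
    using set by (intro Bochner_Integration.integrable_add integrable_mult_right integrable_real_indicator)
      (auto simp: less_top[symmetric])
  show "integrable unit_lborel (\<lambda>T. if T \<le> t then b else a)"
    using int by (subst Bochner_Integration.integrable_cong[OF refl eq]) auto
  have "measure unit_lborel {0..t} = t"
    using assms by (simp add: measure_restrict_space)
  hence "(\<integral>T. (a + (b - a) * indicator {0..t} T) \<partial>unit_lborel) = a + (b - a) * t"
    using set prob_space assms
    by (subst Bochner_Integration.integral_add) (auto simp: less_top[symmetric] min_def)
  moreover have "(\<integral>T. (if T \<le> t then b else a) \<partial>unit_lborel)
      = (\<integral>T. (a + (b - a) * indicator {0..t} T) \<partial>unit_lborel)"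
    by (intro Bochner_Integration.integral_cong refl eq)
  ultimately show "(\<integral>T. (if T \<le> t then b else a) \<partial>unit_lborel) = (1 - t) * a + t * b"
    by (simp only:) (simp add: algebra_simps)
qed

section \<open>Bernstein sums as averages over monotone maps\<close>

lemma Bernstein_Suc_Suc:
  "Bernstein (Suc n) (Suc k) t = t * Bernstein n k t + (1 - t) * Bernstein n (Suc k) t"
proof (cases "k < n")
  case True
  hence pow: "(1 - t) ^ (n - k) = (1 - t) * (1 - t) ^ (n - Suc k)"
    by (metis Suc_diff_Suc power_Suc)
  show ?thesis
    by (simp add: Bernstein_def pow algebra_simps)
next
  case False
  hence zero: "n choose Suc k = 0" "n - k = 0"
    by (auto intro: binomial_eq_0)
  show ?thesis
    by (simp add: Bernstein_def zero)
qed

text \<open>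
  The probabilistic reading: condition on the outcome of one of the \<open>n + 1\<close> trials with success
  probability \<open>t\<close>; a success shifts the count by one.
\<close>

lemma Bernstein_sum_Suc:
  "(\<Sum>k\<le>Suc n. Bernstein (Suc n) k t * c k) =
     (1 - t) * (\<Sum>k\<le>n. Bernstein n k t * c k) + t * (\<Sum>k\<le>n. Bernstein n k t * c (Suc k))"
proof -
  have "(1 - t) * (\<Sum>k\<le>n. Bernstein n k t * c k) = (1 - t) * (\<Sum>k\<le>Suc n. Bernstein n k t * c k)"
    by (simp add: Bernstein_def)
  also have "\<dots> = (1 - t) * Bernstein n 0 t * c 0
      + (\<Sum>k\<le>n. (1 - t) * Bernstein n (Suc k) t * c (Suc k))"
    by (subst sum.atMost_Suc_shift) (simp add: algebra_simps sum_distrib_left)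
  finally have low: "(1 - t) * (\<Sum>k\<le>n. Bernstein n k t * c k) = \<dots>" .
  have zero: "Bernstein (Suc n) 0 t = (1 - t) * Bernstein n 0 t"
    by (simp add: Bernstein_def)
  have "(\<Sum>k\<le>n. (t * Bernstein n k t + (1 - t) * Bernstein n (Suc k) t) * c (Suc k)) =
      t * (\<Sum>k\<le>n. Bernstein n k t * c (Suc k)) + (\<Sum>k\<le>n. (1 - t) * Bernstein n (Suc k) t * c (Suc k))"
    unfolding sum_distrib_left sum.distrib[symmetric] by (intro sum.cong refl) (simp add: algebra_simps)
  thus ?thesis
    unfolding low sum.atMost_Suc_shift[of _ n] Bernstein_Suc_Suc zero by simp
qed

text \<open>
  A bound on weighted increments of \<open>a\<close> along monotone integer-valued maps passes to Bernstein sums.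
  The additional shift \<open>m\<close> makes the induction work: it collects the thresholds
  \<open>t \<mapsto> (if T \<le> t then 1 else 0)\<close> fixed so far. Integrating the sum of degree \<open>n\<close> over one more
  threshold gives the sum of degree \<open>n + 1\<close>, and adding a threshold to \<open>m\<close> keeps it monotone.
  The index of \<open>a\<close> never exceeds \<open>N\<close>, so the bound concerns only \<open>a 0, \<dots>, a N\<close>.
\<close>

lemma Bernstein_weighted_increments_le:
  fixes a :: "nat \<Rightarrow> real" and x y :: "'j \<Rightarrow> real"
  assumes w: "\<And>j. j \<in> J \<Longrightarrow> 0 \<le> w j"
    and x: "\<And>j. j \<in> J \<Longrightarrow> x j \<in> {0..1}" and y: "\<And>j. j \<in> J \<Longrightarrow> y j \<in> {0..1}"
    and bound: "\<And>m :: real \<Rightarrow> nat. mono m \<Longrightarrow> (\<And>t. m t \<le> N) \<Longrightarrow>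
          (\<Sum>j\<in>J. w j * \<bar>a (m (y j)) - a (m (x j))\<bar>) \<le> C"
    and m: "mono m" "\<And>t. n + m t \<le> N"
  shows "(\<Sum>j\<in>J. w j * \<bar>(\<Sum>k\<le>n. Bernstein n k (y j) * a (k + m (y j)))
                     - (\<Sum>k\<le>n. Bernstein n k (x j) * a (k + m (x j)))\<bar>) \<le> C"
  using m
proof (induction n arbitrary: m)
  case 0
  thus ?case
    using bound[of m] by (simp add: Bernstein_def)
next
  case (Suc n)
  define F where "F m t = (\<Sum>k\<le>n. Bernstein n k t * a (k + m t))" for m :: "real \<Rightarrow> nat" and t
  define jump where "jump T t = m t + (if T \<le> t then 1 else 0)" for T t :: real
  have F_jump: "F (jump T) t = (if T \<le> t then F (\<lambda>t. Suc (m t)) t else F m t)" for T t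
    by (simp add: F_def jump_def)
  have step: "(\<Sum>k\<le>Suc n. Bernstein (Suc n) k t * a (k + m t)) = (\<integral>T. F (jump T) t \<partial>unit_lborel)"
    if "t \<in> {0..1}" for t
    using that unfolding F_jump
    by (subst Bernstein_sum_Suc, subst integral_unit_threshold) (auto simp: F_def)
  have int: "integrable unit_lborel (\<lambda>T. F (jump T) t)" if "t \<in> {0..1}" for t
    using that unfolding F_jump by (intro integrable_unit_threshold) auto
  have "(\<Sum>j\<in>J. w j * \<bar>\<integral>T. (F (jump T) (y j) - F (jump T) (x j)) \<partial>unit_lborel\<bar>) \<le> C"
  proof (rule weighted_sum_abs_expectation_le[OF prob_space_unit_lborel])
    fix T
    have "mono (jump T)"
      using Suc.prems(1) by (auto simp: mono_def jump_def intro: le_SucI)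
    moreover have "n + jump T t \<le> N" for t
      using Suc.prems(2)[of t] by (simp add: jump_def)
    ultimately show "(\<Sum>j\<in>J. w j * \<bar>F (jump T) (y j) - F (jump T) (x j)\<bar>) \<le> C"
      unfolding F_def by (rule Suc.IH)
  qed (use w x y int in auto)
  also have "(\<Sum>j\<in>J. w j * \<bar>\<integral>T. (F (jump T) (y j) - F (jump T) (x j)) \<partial>unit_lborel\<bar>) =
      (\<Sum>j\<in>J. w j * \<bar>(\<Sum>k\<le>Suc n. Bernstein (Suc n) k (y j) * a (k + m (y j)))
                  - (\<Sum>k\<le>Suc n. Bernstein (Suc n) k (x j) * a (k + m (x j)))\<bar>)"
    using x y int by (intro sum.cong refl) (simp add: step del: sum.atMost_Suc)
  finally show ?case .
qed

section \<open>Kantorovich polynomials do not increase the variation\<close>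

lemma
  assumes L: "Lambda_sequence \<Lambda>" and f: "f \<in> Lambda_BV \<Lambda>" and k: "k \<le> n"
  shows Lambda_BV_integrable_cell:
      "integrable unit_lborel (\<lambda>u. f ((real k + u) / real (n + 1)))" (is ?int)
    and Lambda_BV_cell_average:
      "real (n + 1) * (LINT t:{real k / real (n + 1)..real (k + 1) / real (n + 1)}|lebesgue. f t) =
        (\<integral>u. f ((real k + u) / real (n + 1)) \<partial>unit_lborel)" (is ?avg)
proof -
  interpret prob_space unit_lborel by (rule prob_space_unit_lborel)
  (* f is uncontrolled outside the unit interval; g is globally bounded and Borel measurable. *)
  define g where "g t = indicator {0..1} t * f t" for t :: real
  have [measurable]: "g \<in> borel_measurable borel"
    using Lambda_BV_borel_measurable[OF L f] by (simp add: g_def[abs_def])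
  define c where "c = 1 / real (n + 1)"
  have c: "c > 0" "real (k + 1) * c \<le> 1"
    using k by (auto simp: c_def)
  have cell: "(real k + u) / real (n + 1) = real k * c + c * u" for u
    by (simp add: c_def add_divide_distrib)
  have "real k * c + c * u \<in> {0..1}" if "u \<in> {0..1}" for u
  proof -
    have "c * u \<le> c * 1"
      using c that by (intro mult_left_mono) auto
    moreover have "real k * c + c \<le> 1" "0 \<le> real k * c" "0 \<le> c * u"
      using c that by (auto simp: algebra_simps)
    ultimately show ?thesis by simp
  qed
  hence fg: "f ((real k + u) / real (n + 1)) = g (real k * c + c * u)" if "u \<in> {0..1}" for u
    unfolding cell using that by (simp add: g_def)
  obtain B where B: "\<And>t. t \<in> {0..1} \<Longrightarrow> \<bar>f t\<bar> \<le> B"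
    using Lambda_BV_bounded[OF L f] by blast
  have "\<bar>g t\<bar> \<le> max 0 B" for t
    using B[of t] by (auto simp: g_def indicator_def)
  hence "integrable unit_lborel (\<lambda>u. g (real k * c + c * u))"
    by (intro integrable_const_bound[where B = "max 0 B"] measurable_restrict_space1) auto
  thus ?int
    using fg by (subst Bochner_Integration.integrable_cong[OF refl]) (auto simp: space_restrict_space)
  let ?I = "{real k * c..real (k + 1) * c}"
  have "(LINT t:?I|lebesgue. f t) = (\<integral>t. indicator ?I t * g t \<partial>lebesgue)"
    unfolding set_lebesgue_integral_def
  proof (intro Bochner_Integration.integral_cong refl)
    fix t
    have "0 \<le> real k * c"
      using c by simp
    thus "indicator ?I t *\<^sub>R f t = indicator ?I t * g t"
      using c(2) by (auto simp: g_def indicator_def)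
  qed
  also have "\<dots> = (\<integral>t. indicator ?I t * g t \<partial>lborel)"
    by (intro integral_completion) measurable
  also have "\<dots> = c * (\<integral>u. indicator ?I (real k * c + c * u) * g (real k * c + c * u) \<partial>lborel)"
    using c(1) by (subst lborel_integral_real_affine[where c = c and t = "real k * c"]) auto
  also have "(\<lambda>u. indicator ?I (real k * c + c * u) :: real) = indicator {0..1}"
    using c(1) by (auto simp: indicator_def fun_eq_iff algebra_simps zero_le_mult_iff)
  also have "(\<integral>u. indicator {0..1} u * g (real k * c + c * u) \<partial>lborel)
      = (\<integral>u. g (real k * c + c * u) \<partial>unit_lborel)"
    by (subst integral_restrict_space) auto
  also have "\<dots> = (\<integral>u. f ((real k + u) / real (n + 1)) \<partial>unit_lborel)"
    using fg by (intro Bochner_Integration.integral_cong) (auto simp: space_restrict_space)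
  finally show ?avg
    by (simp add: c_def)
qed

lemma Kantorovich_eq_expectation:
  assumes L: "Lambda_sequence \<Lambda>" and f: "f \<in> Lambda_BV \<Lambda>"
  shows "Kantorovich n f t =
    (\<integral>u. (\<Sum>k\<le>n. Bernstein n k t * f ((real k + u) / real (n + 1))) \<partial>unit_lborel)"
proof -
  have "Kantorovich n f t =
      (\<Sum>k\<le>n. Bernstein n k t * (\<integral>u. f ((real k + u) / real (n + 1)) \<partial>unit_lborel))"
    unfolding Kantorovich_def atMost_atLeast0
    by (intro sum.cong refl) (simp only: Lambda_BV_cell_average[OF L f] mult.assoc atLeastAtMost_iff)
  also have "\<dots> = (\<integral>u. (\<Sum>k\<le>n. Bernstein n k t * f ((real k + u) / real (n + 1))) \<partial>unit_lborel)"
    by (subst Bochner_Integration.integral_sum) (auto simp: Lambda_BV_integrable_cell[OF L f, simplified])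
  finally show ?thesis .
qed

theorem theorem2:
  fixes \<Lambda> :: "nat \<Rightarrow> real" and f :: "real \<Rightarrow> real" and n :: nat
  assumes "Lambda_sequence \<Lambda>"
    and "f \<in> Lambda_BV \<Lambda>"
    and "n \<ge> 1"
  shows "Lambda_variation \<Lambda> (Kantorovich n f) \<le> Lambda_variation \<Lambda> f"
proof -
  note L = assms(1) and f = assms(2)
  define V where "V = enn2real (Lambda_variation \<Lambda> f)"
  have V: "Lambda_variation \<Lambda> f = ennreal V"
    using f by (simp add: V_def Lambda_BV_def)
  have "Lambda_sum \<Lambda> (Kantorovich n f) \<I> \<le> V" if fam: "\<I> \<in> interval_families" for \<I>
  proof -
    define J where "J = {1..length \<I>}"
    define w where "w k = 1 / \<Lambda> k" for k
    define x where "x k = fst (\<I> ! (k - 1))" for k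
    define y where "y k = snd (\<I> ! (k - 1))" for k
    define G where "G u t = (\<Sum>k\<le>n. Bernstein n k t * f ((real k + u) / real (n + 1)))" for u t
    have w: "0 \<le> w j" if "j \<in> J" for j
      using that Lambda_sequence_pos[OF L, of j] by (simp add: w_def J_def)
    have xy: "x j \<in> {0..1}" "y j \<in> {0..1}" if "j \<in> J" for j
    proof -
      have "\<I> ! (j - 1) \<in> set \<I>"
        using that by (auto simp: J_def)
      hence "0 \<le> x j \<and> x j \<le> y j \<and> y j \<le> 1"
        using fam by (simp add: interval_families_def x_def y_def)
      thus "x j \<in> {0..1}" "y j \<in> {0..1}" by auto
    qed
    have G_bound: "(\<Sum>j\<in>J. w j * \<bar>G u (y j) - G u (x j)\<bar>) \<le> V" if u: "u \<in> {0..1}" for u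
    proof -
      have "(\<Sum>j\<in>J. w j * \<bar>f ((real (m (y j)) + u) / real (n + 1))
                       - f ((real (m (x j)) + u) / real (n + 1))\<bar>) \<le> V"
        if m: "mono m" "\<And>t. m t \<le> n" for m :: "real \<Rightarrow> nat"
      proof -
        (* One outcome of the random monotone map: m is the counting function S. *)
        define \<phi> where "\<phi> t = (real (m t) + u) / real (n + 1)" for t
        have "map (map_prod \<phi> \<phi>) \<I> \<in> interval_families"
        proof (rule map_interval_families[OF fam])
          show "\<phi> s \<le> \<phi> t" if "s \<le> t" for s t
            using monoD[OF m(1) that] by (simp add: \<phi>_def divide_right_mono)
          show "0 \<le> \<phi> t \<and> \<phi> t \<le> 1" for t
            using m(2)[of t] u by (auto simp: \<phi>_def field_simps)
        qed
        hence "Lambda_sum \<Lambda> f (map (map_prod \<phi> \<phi>) \<I>) \<le> V"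
          unfolding V_def by (rule Lambda_sum_le_variation[OF f])
        also have "Lambda_sum \<Lambda> f (map (map_prod \<phi> \<phi>) \<I>) =
            (\<Sum>j\<in>J. w j * \<bar>f (\<phi> (y j)) - f (\<phi> (x j))\<bar>)"
          unfolding Lambda_sum_def J_def w_def x_def y_def by (intro sum.cong) auto
        finally show ?thesis
          by (simp add: \<phi>_def)
      qed
      hence "(\<Sum>j\<in>J. w j * \<bar>(\<Sum>k\<le>n. Bernstein n k (y j) * f ((real (k + 0) + u) / real (n + 1)))
          - (\<Sum>k\<le>n. Bernstein n k (x j) * f ((real (k + 0) + u) / real (n + 1)))\<bar>) \<le> V"
        using w xy
        by (intro Bernstein_weighted_increments_le[where N = n and m = "\<lambda>_. 0" and
              a = "\<lambda>k. f ((real k + u) / real (n + 1))"]) (auto simp: mono_def)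
      thus ?thesis
        by (simp add: G_def)
    qed
    have int: "integrable unit_lborel (\<lambda>u. G u t)" for t
      unfolding G_def
      by (intro Bochner_Integration.integrable_sum integrable_mult_right Lambda_BV_integrable_cell[OF L f]) auto
    have "(\<Sum>j\<in>J. w j * \<bar>\<integral>u. (G u (y j) - G u (x j)) \<partial>unit_lborel\<bar>) \<le> V"
      using int w G_bound
      by (intro weighted_sum_abs_expectation_le[OF prob_space_unit_lborel]) (auto simp: space_restrict_space)
    also have "(\<Sum>j\<in>J. w j * \<bar>\<integral>u. (G u (y j) - G u (x j)) \<partial>unit_lborel\<bar>) =
        Lambda_sum \<Lambda> (Kantorovich n f) \<I>"
      unfolding Lambda_sum_def J_def[symmetric] x_def[symmetric] y_def[symmetric]
        Kantorovich_eq_expectation[OF L f] G_def[symmetric]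
      using int by (simp add: w_def)
    finally show ?thesis .
  qed
  thus ?thesis
    unfolding V unfolding Lambda_variation_def by (auto intro!: SUP_least ennreal_leI)
qed

end
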